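(* Let $P,Q\in\mathbb{K}^{m\times m}$ be projections that commute, i.e. $PQ=QP$. Then \[P\vee Q=P+Q-PQ=S(TS)^+T,\qquad\text{where } S=(P+Q)(P+Q)^+,\quad T=(P+Q)^+(P+Q).\] Moreover, \[P\wedge Q=PQ=S(TS)^+T,\qquad\text{for } S=(PQ)(PQ)^+,\quad T=(PQ)^+(PQ).\] In particular, if $P,Q$ are orthogonal projections, then in both cases $S=T$ and \[P\vee Q=(P+Q)(P+Q)^+,\qquad P\wedge Q=PQ=(PQ)(PQ)^+.\]
   Context: $\mathbb{K}=\mathbb{R}$ or $\mathbb{K}=\mathbb{C}$; $M^*$ is the conjugate transpose and $M^+$ the Moore--Penrose pseudoinverse of $M$. A projection is a square matrix $P$ with $P^2=P$ (not necessarily Hermitian); it is an orthogonal projection if moreover $P^*=P$. For commuting projections $P,Q$ one defines $P\wedge Q:=PQ$ and $P\vee Q:=P+Q-PQ$. *)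

theory Defs
  imports "Jordan_Normal_Form.Schur_Decomposition"
begin

text \<open>
  The library's \<^const>\<open>mat_adjoint\<close> is the conjugate transpose; \<^const>\<open>conjugate\<close> is the identity
  on \<^typ>\<open>real\<close> and complex conjugation on \<^typ>\<open>complex\<close>.
\<close>

definition is_projection :: "nat \<Rightarrow> 'a :: field mat \<Rightarrow> bool" where
  "is_projection m P \<longleftrightarrow> P \<in> carrier_mat m m \<and> P * P = P"

definition is_orthogonal_projection :: "nat \<Rightarrow> 'a :: conjugatable_field mat \<Rightarrow> bool" where
  "is_orthogonal_projection m P \<longleftrightarrow> is_projection m P \<and> mat_adjoint P = P"

text \<open>
  The four Penrose equations. A matrix over the reals or the complex numbers, square or not, has
  exactly one solution, so the definite description in \<open>pinv\<close> is proper for those types.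
\<close>

definition is_pinv :: "'a :: conjugatable_field mat \<Rightarrow> 'a mat \<Rightarrow> bool" where
  "is_pinv M X \<longleftrightarrow> X \<in> carrier_mat (dim_col M) (dim_row M) \<and>
     M * X * M = M \<and> X * M * X = X \<and>
     mat_adjoint (M * X) = M * X \<and> mat_adjoint (X * M) = X * M"

definition pinv :: "'a :: conjugatable_field mat \<Rightarrow> 'a mat" where
  "pinv M = (THE X. is_pinv M X)"

text \<open>These two are only meaningful for commuting projections.\<close>

definition proj_meet :: "'a :: field mat \<Rightarrow> 'a mat \<Rightarrow> 'a mat" where
  "proj_meet P Q = P * Q"

definition proj_join :: "'a :: field mat \<Rightarrow> 'a mat \<Rightarrow> 'a mat" where
  "proj_join P Q = P + Q - P * Q"

end

theory Submission
  imports Defs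
begin

text \<open>
  Write \<open>A\<close> for \<open>P + Q\<close> or \<open>P * Q\<close>, and \<open>E\<close> for the join or the meet respectively. The claim rests on
  \<open>A\<close> and \<open>E\<close> having the same range and the same kernel. Algebraically, there is a \<open>B\<close> with
  \<open>A * B = B * A = E\<close> and \<open>E * A = A\<close>: for the meet \<open>B = A = E\<close>, and for the join
  \<open>B = P + Q - (3/2) P Q\<close>, since \<open>(P + Q) (P + Q - c P Q) = P + Q + (2 - 2 c) P Q\<close>.
  The locale \<open>group_invertible\<close> collects these equations.

  Now \<open>S = A A\<^sup>+\<close> is the orthogonal projection onto the range of \<open>A\<close>, which is that of \<open>E\<close>, so
  \<open>S E = E\<close> and \<open>E S = S\<close>. Likewise \<open>T = A\<^sup>+ A\<close> is the orthogonal projection along the kernel of \<open>E\<close>,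
  so \<open>E T = E\<close> and \<open>T E = T\<close>. These four equations give \<open>(T S) E = T\<close> and \<open>E (T S) = S\<close>, from which
  \<open>E\<close> satisfies the Penrose equations for \<open>T S\<close> (lemma \<open>is_pinv_projection_product\<close>). Hence \<open>S (T S)\<^sup>+ T = S E T = E\<close>.
  If \<open>E\<close> is Hermitian, taking adjoints in \<open>E S = S\<close> gives \<open>S = S E = E\<close>, and similarly \<open>T = E\<close>.

  This uses \<open>A\<^sup>+\<close> only through the Penrose equations, so it has to be shown that \<open>A\<^sup>+\<close> exists. The
  key is the matrix \<open>Z = E + E\<^sup>* - 1\<close>, which is invertible for every idempotent \<open>E\<close> because the
  Hermitian form is definite. Then \<open>E Z\<^sup>-\<^sup>1\<close> is the orthogonal projection \<open>S\<close> onto the range of \<open>E\<close>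
  (lemma \<open>idempotent_range_projection\<close>), the same lemma for \<open>E\<^sup>*\<close> yields \<open>T\<close>, and
  \<open>T B S\<close> is a pseudoinverse of \<open>A\<close>.

  Everything holds over any field in the class \<open>conjugatable_ordered_field\<close>, so the real and the
  complex case are instances of one lemma.
\<close>

section \<open>The conjugate transpose\<close>

lemma dim_mat_adjoint [simp]:
  "dim_row (mat_adjoint A) = dim_col A" "dim_col (mat_adjoint A) = dim_row A"
  unfolding mat_adjoint_def by auto

lemma mat_adjoint_carrier [simp]:
  "A \<in> carrier_mat n m \<Longrightarrow> mat_adjoint A \<in> carrier_mat m n"
  by (auto intro!: carrier_matI)

lemma mat_adjoint_index [simp]:
  assumes "i < dim_col A" "j < dim_row A"
  shows "mat_adjoint A $$ (i, j) = conjugate (A $$ (j, i))"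
  using assms unfolding mat_adjoint_def by (simp add: mat_of_rows_index)

lemma mat_adjoint_adjoint [simp]: "mat_adjoint (mat_adjoint A) = A"
  by (rule eq_matI) auto

lemma mat_adjoint_mult:
  assumes "A \<in> carrier_mat n m" "B \<in> carrier_mat m k"
  shows "mat_adjoint (A * B) = mat_adjoint B * mat_adjoint A"
proof (rule eq_matI)
  fix i j
  assume "i < dim_row (mat_adjoint B * mat_adjoint A)"
    and "j < dim_col (mat_adjoint B * mat_adjoint A)"
  then have "i < k" "j < n"
    using assms by auto
  then show "mat_adjoint (A * B) $$ (i, j) = (mat_adjoint B * mat_adjoint A) $$ (i, j)"
    using assms
    by (simp add: scalar_prod_def sum_conjugate conjugate_dist_mul mult.commute)
qed (use assms in auto)

lemma mat_adjoint_add: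
  assumes "A \<in> carrier_mat n m" "B \<in> carrier_mat n m"
  shows "mat_adjoint (A + B) = mat_adjoint A + mat_adjoint B"
  using assms by (intro eq_matI) (auto simp: conjugate_dist_add)

lemma mat_adjoint_minus:
  assumes "A \<in> carrier_mat n m" "B \<in> carrier_mat n m"
  shows "mat_adjoint (A - B) = mat_adjoint A - mat_adjoint B"
  using assms
  by (intro eq_matI) (auto simp: diff_conv_add_uminus conjugate_dist_add conjugate_neg
      simp del: add_uminus_conv_diff)

lemma conjugate_one [simp]: "conjugate (1 :: 'a :: conjugatable_field) = 1"
proof -
  have "conjugate (1 :: 'a) * conjugate 1 = conjugate 1 * 1"
    using conjugate_dist_mul[of "1 :: 'a" 1] by simp
  then show ?thesis
    by (subst (asm) mult_cancel_left) simp
qed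

text \<open>
  The join formula divides by two. The order rules out characteristic two: \<open>1\<close> is positive, being
  the product of \<open>1\<close> and its conjugate.
\<close>

lemma conjugatable_two_neq_zero: "(2 :: 'a :: conjugatable_ordered_field) \<noteq> 0"
proof -
  have "(0 :: 'a) < 1"
    using conjugate_square_greater_0[of "1 :: 'a"] by simp
  then have "(0 :: 'a) < 1 + 1"
    by (rule add_pos_pos) fact
  then show ?thesis
    by simp
qed

lemma mat_adjoint_one [simp]: "mat_adjoint (1\<^sub>m n :: 'a :: conjugatable_field mat) = 1\<^sub>m n"
  by (intro eq_matI) auto

lemma mat_adjoint_cscalar_prod:
  assumes "A \<in> carrier_mat n m" "v \<in> carrier_vec m" "w \<in> carrier_vec n"
  shows "(A *\<^sub>v v) \<bullet>c w = v \<bullet>c (mat_adjoint A *\<^sub>v w)"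
proof -
  have "(A *\<^sub>v v) \<bullet>c w = (\<Sum>i<n. \<Sum>j<m. A $$ (i, j) * v $ j * conjugate (w $ i))"
    using assms by (simp add: scalar_prod_def atLeast0LessThan sum_distrib_right)
  also have "\<dots> = (\<Sum>j<m. \<Sum>i<n. A $$ (i, j) * v $ j * conjugate (w $ i))"
    by (rule sum.swap)
  also have "\<dots> = v \<bullet>c (mat_adjoint A *\<^sub>v w)"
    using assms
    by (simp add: scalar_prod_def atLeast0LessThan sum_distrib_left sum_conjugate
        conjugate_dist_mul mult_ac)
  finally show ?thesis .
qed

text \<open>
  If \<open>A\<^sup>* A v = 0\<close>, then \<open>\<langle>A v, A v\<rangle> = \<langle>v, A\<^sup>* A v\<rangle> = 0\<close>. The definiteness of the inner product enters
  the development only here.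
\<close>

lemma mat_adjoint_mult_kernel:
  fixes A :: "'a :: conjugatable_ordered_field mat"
  assumes A: "A \<in> carrier_mat n m" and v: "v \<in> carrier_vec m"
    and 0: "mat_adjoint A *\<^sub>v (A *\<^sub>v v) = 0\<^sub>v m"
  shows "A *\<^sub>v v = 0\<^sub>v n"
proof -
  have Av: "A *\<^sub>v v \<in> carrier_vec n"
    using A v by simp
  have "(A *\<^sub>v v) \<bullet>c (A *\<^sub>v v) = v \<bullet>c 0\<^sub>v m"
    using mat_adjoint_cscalar_prod[OF A v Av] 0 by simp
  then have "(A *\<^sub>v v) \<bullet>c (A *\<^sub>v v) = 0"
    using v by (simp add: scalar_prod_def)
  then show ?thesis
    using conjugate_square_eq_0_vec[OF Av] by simp
qed

section \<open>The orthogonal projection onto the range of an idempotent\<close>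

text \<open>
  Let \<open>v\<close> be in the kernel of \<open>E + E\<^sup>* - 1\<close>, that is, \<open>E v + E\<^sup>* v = v\<close>. Applying \<open>E\<close> leaves
  \<open>E E\<^sup>* v = 0\<close>, so \<open>E\<^sup>* v = 0\<close> by lemma \<open>mat_adjoint_mult_kernel\<close>; applying \<open>E\<^sup>*\<close> leaves
  \<open>E\<^sup>* E v = 0\<close>, so \<open>E v = 0\<close>. Together \<open>v = 0\<close>.
\<close>

lemma idempotent_plus_adjoint_minus_one_inverse:
  fixes E :: "'a :: conjugatable_ordered_field mat"
  assumes E: "E \<in> carrier_mat m m" and idem: "E * E = E"
  obtains W where "W \<in> carrier_mat m m"
    "W * (E + mat_adjoint E - 1\<^sub>m m) = 1\<^sub>m m" "(E + mat_adjoint E - 1\<^sub>m m) * W = 1\<^sub>m m"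
proof -
  define F where "F = mat_adjoint E"
  define Z where "Z = E + F - 1\<^sub>m m"
  have F: "F \<in> carrier_mat m m" and Z: "Z \<in> carrier_mat m m"
    using E by (auto simp: F_def Z_def)
  have idem': "F * F = F"
    unfolding F_def by (metis E idem mat_adjoint_mult)
  have "v = 0\<^sub>v m" if v: "v \<in> carrier_vec m" and Zv: "Z *\<^sub>v v = 0\<^sub>v m" for v
  proof -
    have EZ: "E * Z = E * F" and FZ: "F * Z = F * E"
      using E F by (auto simp: Z_def idem idem' mult_minus_distrib_mat[of _ m m _ m]
          mult_add_distrib_mat[of _ m m _ m] intro!: eq_matI)
    have "E *\<^sub>v (F *\<^sub>v v) = E *\<^sub>v (Z *\<^sub>v v)"
      using E F Z v EZ by (metis assoc_mult_mat_vec)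
    also have "\<dots> = 0\<^sub>v m"
      using E Zv by (auto intro!: eq_vecI)
    finally have "E *\<^sub>v (F *\<^sub>v v) = 0\<^sub>v m" .
    then have Fv: "F *\<^sub>v v = 0\<^sub>v m"
      using mat_adjoint_mult_kernel[OF F v] by (simp add: F_def)
    have "F *\<^sub>v (E *\<^sub>v v) = F *\<^sub>v (Z *\<^sub>v v)"
      using E F Z v FZ by (metis assoc_mult_mat_vec)
    also have "\<dots> = 0\<^sub>v m"
      using F Zv by (auto intro!: eq_vecI)
    finally have Ev: "E *\<^sub>v v = 0\<^sub>v m"
      using mat_adjoint_mult_kernel[OF E v] by (simp add: F_def)
    have "Z *\<^sub>v v = E *\<^sub>v v + F *\<^sub>v v - v"
      using E F v
      by (simp add: Z_def minus_mult_distrib_mat_vec[of _ m m] add_mult_distrib_mat_vec[of _ m m])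
    then have "- v = 0\<^sub>v m"
      using Zv Ev Fv v by simp
    then show ?thesis
      using v by (metis uminus_zero_vec uminus_uminus_vec)
  qed
  then have "det Z \<noteq> 0"
    using det_0_iff_vec_prod_zero_field[OF Z] by blast
  from det_non_zero_imp_unit[OF Z this, of "()"]
  obtain W where "W \<in> carrier_mat m m" "W * Z = 1\<^sub>m m" "Z * W = 1\<^sub>m m"
    unfolding Units_def ring_mat_def by auto
  then show thesis
    using that unfolding Z_def F_def by blast
qed

text \<open>
  The witness is \<open>S = E W\<close> with \<open>W\<close> the inverse of \<open>Z = E + E\<^sup>* - 1\<close>. From \<open>E Z = E E\<^sup>* = Z E\<^sup>*\<close> and
  \<open>E\<^sup>* Z = E\<^sup>* E = Z E\<close>, multiplication by \<open>W\<close> on both sides gives \<open>W E = E\<^sup>* W\<close> and \<open>E W = W E\<^sup>*\<close>. The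
  second says that \<open>S\<close> is Hermitian, and the first gives \<open>S E = E E\<^sup>* W = E Z W = E\<close>.
\<close>

lemma idempotent_range_projection:
  fixes E :: "'a :: conjugatable_ordered_field mat"
  assumes E: "E \<in> carrier_mat m m" and idem: "E * E = E"
  obtains S where "S \<in> carrier_mat m m" "mat_adjoint S = S" "S * E = E" "E * S = S"
proof -
  define F where "F = mat_adjoint E"
  define Z where "Z = E + F - 1\<^sub>m m"
  obtain W where W: "W \<in> carrier_mat m m" and WZ: "W * Z = 1\<^sub>m m" and ZW: "Z * W = 1\<^sub>m m"
    using idempotent_plus_adjoint_minus_one_inverse[OF E idem] unfolding Z_def F_def by blast
  have F: "F \<in> carrier_mat m m" and Z: "Z \<in> carrier_mat m m"
    using E by (auto simp: F_def Z_def)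
  have idem': "F * F = F"
    unfolding F_def by (metis E idem mat_adjoint_mult)
  have EZ: "E * Z = E * F" and ZF: "Z * F = E * F" and FZ: "F * Z = F * E" and ZE: "Z * E = F * E"
    using E F by (auto simp: Z_def idem idem' mult_minus_distrib_mat[of _ m m _ m]
        mult_add_distrib_mat[of _ m m _ m] minus_mult_distrib_mat[of _ m m _ _ m]
        add_mult_distrib_mat[of _ m m _ _ m] intro!: eq_matI)
  have adjZ: "mat_adjoint Z = Z"
    using E F
    by (simp add: Z_def F_def mat_adjoint_add[of _ m m] mat_adjoint_minus[of _ m m]
        comm_add_mat[of "mat_adjoint E" m m])
  have "mat_adjoint W * Z = 1\<^sub>m m"
    using mat_adjoint_mult[OF Z W] ZW adjZ by simp
  then have adjW: "mat_adjoint W = W"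
    using assoc_mult_mat[OF mat_adjoint_carrier[OF W] Z W] ZW W by simp
  have cancel: "W * (Z * X) = X" "X * Z * W = X" if "X \<in> carrier_mat m m" for X
    using that assoc_mult_mat[OF W Z that] assoc_mult_mat[OF that Z W] WZ ZW by simp_all
  have EW: "E * W = W * F"
  proof -
    have "E * W = W * (F * Z) * W"
      using cancel(1)[OF E] by (simp only: ZE FZ)
    also have "\<dots> = W * F * Z * W"
      using assoc_mult_mat[OF W F Z] by simp
    also have "\<dots> = W * F"
      using W F by (intro cancel) auto
    finally show ?thesis .
  qed
  have WE: "W * E = F * W"
  proof -
    have "W * E = W * E * Z * W"
      using W E by (intro cancel(2)[symmetric]) auto
    also have "\<dots> = W * (Z * F) * W"
      using assoc_mult_mat[OF W E Z] by (simp only: EZ ZF)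
    also have "\<dots> = F * W"
      by (simp only: cancel(1)[OF F])
    finally show ?thesis .
  qed
  show thesis
  proof
    show "E * W \<in> carrier_mat m m"
      using E W by simp
    show "mat_adjoint (E * W) = E * W"
      using mat_adjoint_mult[OF E W] adjW EW by (simp add: F_def)
    have "E * W * E = E * F * W"
      using assoc_mult_mat[OF E W E] assoc_mult_mat[OF E F W] WE by simp
    also have "\<dots> = E"
      using cancel(2)[OF E] by (simp only: EZ)
    finally show "E * W * E = E" .
    show "E * (E * W) = E * W"
      using assoc_mult_mat[OF E E W] idem by simp
  qed
qed

text \<open>The orthogonal projection with the kernel of \<open>E\<close> is the one onto the range of \<open>E\<^sup>*\<close>.\<close>

corollary idempotent_corange_projection:
  fixes E :: "'a :: conjugatable_ordered_field mat"
  assumes E: "E \<in> carrier_mat m m" and idem: "E * E = E"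
  obtains T where "T \<in> carrier_mat m m" "mat_adjoint T = T" "T * E = T" "E * T = E"
proof -
  have F: "mat_adjoint E \<in> carrier_mat m m" and idem': "mat_adjoint E * mat_adjoint E = mat_adjoint E"
    using E mat_adjoint_mult[OF E E] idem by auto
  obtain T where T: "T \<in> carrier_mat m m" "mat_adjoint T = T"
    and "T * mat_adjoint E = mat_adjoint E" "mat_adjoint E * T = T"
    using idempotent_range_projection[OF F idem'] by blast
  then have "E * T = E" "T * E = T"
    using mat_adjoint_mult[OF T(1) F] mat_adjoint_mult[OF F T(1)] by auto
  with T show thesis
    using that by blast
qed

section \<open>The Moore--Penrose pseudoinverse\<close>

text \<open>
  Both \<open>M X\<close> and \<open>M Y\<close> are orthogonal projections onto the range of \<open>M\<close>, hence equal; likewise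
  \<open>X M = Y M\<close>. Then \<open>X = X M X = X M Y = Y M Y = Y\<close>.
\<close>

lemma is_pinv_unique:
  fixes M :: "'a :: conjugatable_field mat"
  assumes X: "is_pinv M X" and Y: "is_pinv M Y"
  shows "X = Y"
proof -
  define n where "n = dim_row M"
  define k where "k = dim_col M"
  have M: "M \<in> carrier_mat n k"
    by (simp add: n_def k_def)
  have XC: "X \<in> carrier_mat k n" and YC: "Y \<in> carrier_mat k n"
    using X Y by (auto simp: is_pinv_def n_def k_def)
  have X: "M * X * M = M" "X * M * X = X" "mat_adjoint (M * X) = M * X" "mat_adjoint (X * M) = X * M"
    and Y: "M * Y * M = M" "Y * M * Y = Y" "mat_adjoint (M * Y) = M * Y" "mat_adjoint (Y * M) = Y * M"
    using X Y by (auto simp: is_pinv_def)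
  note MXC = mult_carrier_mat[OF M XC] and MYC = mult_carrier_mat[OF M YC]
    and XMC = mult_carrier_mat[OF XC M] and YMC = mult_carrier_mat[OF YC M]
  have MX_MY: "M * X * (M * Y) = M * Y" and MY_MX: "M * Y * (M * X) = M * X"
    using assoc_mult_mat[OF MXC M YC] assoc_mult_mat[OF MYC M XC] X(1) Y(1) by simp_all
  have XM_YM: "X * M * (Y * M) = X * M" and YM_XM: "Y * M * (X * M) = Y * M"
    using assoc_mult_mat[OF XC M YMC] assoc_mult_mat[OF YC M XMC]
      assoc_mult_mat[OF M YC M] assoc_mult_mat[OF M XC M] X(1) Y(1)
    by simp_all
  have "mat_adjoint (M * X * (M * Y)) = M * Y * (M * X)"
    using mat_adjoint_mult[OF MXC MYC] X(3) Y(3) by simp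
  then have MX: "M * X = M * Y"
    by (simp only: MX_MY MY_MX Y(3))
  have "mat_adjoint (Y * M * (X * M)) = X * M * (Y * M)"
    using mat_adjoint_mult[OF YMC XMC] X(4) Y(4) by simp
  then have XM: "X * M = Y * M"
    by (simp only: XM_YM YM_XM Y(4))
  have "X = X * (M * X)"
    using assoc_mult_mat[OF XC M XC] X(2) by simp
  also have "\<dots> = Y * M * Y"
    using assoc_mult_mat[OF XC M YC] by (simp only: MX XM)
  finally show ?thesis
    by (simp only: Y(2))
qed

lemma pinv_eqI: "is_pinv M X \<Longrightarrow> pinv M = X"
  unfolding pinv_def by (rule the_equality) (auto intro: is_pinv_unique)

text \<open>
  The relations between \<open>E\<close> and the orthogonal projections with its range and its kernel give
  \<open>(T S) E = T\<close> and \<open>E (T S) = S\<close>, which are Hermitian, as the Penrose equations demand.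
\<close>

lemma is_pinv_projection_product:
  fixes E :: "'a :: conjugatable_field mat"
  assumes S: "S \<in> carrier_mat m m" "mat_adjoint S = S" "S * E = E" "E * S = S"
    and T: "T \<in> carrier_mat m m" "mat_adjoint T = T" "T * E = T" "E * T = E"
    and E: "E \<in> carrier_mat m m"
  shows "is_pinv (T * S) E"
proof -
  note assoc = assoc_mult_mat[of _ m m _ m _ m]
  have TSE: "T * S * E = T"
    using assoc[OF T(1) S(1) E] S(3) T(3) by simp
  have ETS: "E * (T * S) = S"
    using assoc[OF E T(1) S(1)] S(4) T(4) by simp
  have "T * T = T"
    using assoc[OF T(1) E T(1)] T(3,4) by simp
  then have "T * (T * S) = T * S"
    using assoc[OF T(1) T(1) S(1)] by simp
  moreover have "dim_row (T * S) = m" "dim_col (T * S) = m"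
    using S(1) T(1) by auto
  ultimately show ?thesis
    unfolding is_pinv_def TSE ETS using S T E by simp
qed

section \<open>Matrices with the range and the kernel of an idempotent\<close>

text \<open>
  The equations say that \<open>A\<close> is invertible in a multiplicative group of matrices whose unit is the
  idempotent \<open>E\<close>, that is, that \<open>A\<close> has a group inverse, namely \<open>E B\<close>. They are the algebraic form of
  \<open>A\<close> and \<open>E\<close> having the same range and the same kernel.
\<close>

locale group_invertible =
  fixes m :: nat and A B E :: "'a :: conjugatable_ordered_field mat"
  assumes A [simp]: "A \<in> carrier_mat m m"
    and B [simp]: "B \<in> carrier_mat m m"
    and AB: "A * B = E" and BA: "B * A = E"
    and EA: "E * A = A"
begin

lemmas mult_closed [simp] = mult_carrier_mat[of _ m m _ m]

lemma E [simp]: "E \<in> carrier_mat m m"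
  using mult_closed[OF A B] by (simp add: AB)

lemma AE: "A * E = A"
  using assoc_mult_mat[OF A B A] EA AB BA by simp

lemma idem: "E * E = E"
  using assoc_mult_mat[OF E A B] EA AB by simp

text \<open>
  With \<open>S\<close> and \<open>T\<close> the orthogonal projections that share the range and the kernel of \<open>E\<close>
  respectively, \<open>X = T B S\<close> satisfies \<open>A X = S\<close> and \<open>X A = T\<close>. This shows that a pseudoinverse
  exists, so that the definite description denotes it.
\<close>

lemma is_pinv_pinv: "is_pinv A (pinv A)"
proof -
  obtain S where S [simp]: "S \<in> carrier_mat m m"
    and S': "mat_adjoint S = S" "S * E = E" "E * S = S"
    using idempotent_range_projection[OF E idem] by blast
  obtain T where T [simp]: "T \<in> carrier_mat m m"
    and T': "mat_adjoint T = T" "T * E = T" "E * T = E"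
    using idempotent_corange_projection[OF E idem] by blast
  have SA: "S * A = A"
    using assoc_mult_mat[OF S E A] S'(2) EA by simp
  have AT: "A * T = A"
    using assoc_mult_mat[OF A E T] T'(3) AE by simp
  have AX: "A * (T * B * S) = S"
  proof -
    have "A * (T * B * S) = A * T * B * S"
      by (simp add: assoc_mult_mat[of _ m m _ m _ m])
    also have "\<dots> = S"
      by (simp only: AT AB S')
    finally show ?thesis .
  qed
  have XA: "T * B * S * A = T"
  proof -
    have "T * B * S * A = T * (B * (S * A))"
      by (simp add: assoc_mult_mat[of _ m m _ m _ m])
    also have "\<dots> = T"
      by (simp only: SA BA T')
    finally show ?thesis .
  qed
  have TT: "T * T = T"
    using assoc_mult_mat[OF T E T] T' by simp
  have "T * (T * B * S) = T * T * B * S"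
    by (simp add: assoc_mult_mat[of _ m m _ m _ m])
  then have "T * (T * B * S) = T * B * S"
    by (simp only: TT)
  moreover have "T * B * S \<in> carrier_mat m m"
    by simp
  moreover have "dim_row A = m" "dim_col A = m"
    by (rule carrier_matD[OF A])+
  ultimately have X: "is_pinv A (T * B * S)"
    unfolding is_pinv_def AX XA by (simp only: SA S'(1) T'(1) simp_thms)
  show ?thesis
    unfolding pinv_eqI[OF X] by (rule X)
qed

lemma pinv_carrier [simp]: "pinv A \<in> carrier_mat m m"
  using is_pinv_pinv A by (auto simp: is_pinv_def)

abbreviation "S \<equiv> A * pinv A"
abbreviation "T \<equiv> pinv A * A"

lemma ES: "E * S = S"
  using assoc_mult_mat[OF E A pinv_carrier] EA by simp

lemma SE: "S * E = E"
proof -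
  have "S * E = S * A * B"
    unfolding AB[symmetric] by (simp add: assoc_mult_mat[of _ m m _ m _ m])
  also have "S * A = A"
    using is_pinv_pinv by (simp add: is_pinv_def)
  finally show ?thesis
    by (simp only: AB)
qed

lemma TE: "T * E = T"
  using assoc_mult_mat[OF pinv_carrier A E] AE by simp

lemma ET: "E * T = E"
proof -
  have "E * T = B * (A * pinv A * A)"
    unfolding BA[symmetric] by (simp add: assoc_mult_mat[of _ m m _ m _ m])
  also have "A * pinv A * A = A"
    using is_pinv_pinv by (simp add: is_pinv_def)
  finally show ?thesis
    by (simp only: BA)
qed

lemma S_carrier: "S \<in> carrier_mat m m" and T_carrier: "T \<in> carrier_mat m m"
  by (rule mult_carrier_mat[OF A pinv_carrier], rule mult_carrier_mat[OF pinv_carrier A])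

lemma S_adjoint: "mat_adjoint S = S" and T_adjoint: "mat_adjoint T = T"
  using is_pinv_pinv by (simp_all add: is_pinv_def)

lemma pinv_TS: "pinv (T * S) = E"
  by (rule pinv_eqI, rule is_pinv_projection_product[OF S_carrier S_adjoint SE ES
        T_carrier T_adjoint TE ET E])

lemma S_pinv_TS_T: "S * pinv (T * S) * T = E"
  unfolding pinv_TS SE ET ..

text \<open>An idempotent that is Hermitian is itself the orthogonal projection onto its range.\<close>

lemma S_eq_E: "S = E" and T_eq_E: "T = E" if "mat_adjoint E = E"
proof -
  have "mat_adjoint (E * S) = S * E"
    using mat_adjoint_mult[OF E S_carrier] S_adjoint that by simp
  then show "S = E"
    by (simp only: ES SE S_adjoint)
  have "mat_adjoint (T * E) = E * T"
    using mat_adjoint_mult[OF T_carrier E] T_adjoint that by simp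
  then show "T = E"
    by (simp only: ET TE T_adjoint)
qed

end

section \<open>Meet and join of commuting projections\<close>

context
  fixes m :: nat and P Q :: "'a :: conjugatable_ordered_field mat"
  assumes P: "is_projection m P" and Q: "is_projection m Q" and comm: "P * Q = Q * P"
begin

lemma meet_idem: "P * Q * (P * Q) = P * Q"
proof -
  have [simp]: "P \<in> carrier_mat m m" "Q \<in> carrier_mat m m"
    using P Q by (auto simp: is_projection_def)
  note [simp] = mult_carrier_mat[of _ m m _ m]
  have "P * Q * (P * Q) = P * (Q * P) * Q"
    by (simp add: assoc_mult_mat[of _ m m _ m _ m])
  also have "\<dots> = (P * P) * (Q * Q)"
    unfolding comm[symmetric] by (simp add: assoc_mult_mat[of _ m m _ m _ m])
  finally show ?thesis
    using P Q by (simp add: is_projection_def)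
qed

lemma group_invertible_meet: "group_invertible m (P * Q) (P * Q) (P * Q)"
  using P Q meet_idem by unfold_locales (auto simp: is_projection_def)

text \<open>
  As \<open>P\<close> and \<open>Q\<close> act as the identity on \<open>P Q\<close>, the product \<open>(P + Q) (P + Q - c P Q)\<close> equals
  \<open>P + Q + (2 - 2 c) P Q\<close>, and \<open>c = 3/2\<close> makes it the join.
\<close>

lemma group_invertible_join:
  "group_invertible m (P + Q) (P + Q - (3 / 2) \<cdot>\<^sub>m (P * Q)) (P + Q - P * Q)"
proof -
  define M where "M = P * Q"
  have PQ [simp]: "P \<in> carrier_mat m m" "Q \<in> carrier_mat m m" "M \<in> carrier_mat m m"
    and PP [simp]: "P * P = P" and QQ [simp]: "Q * Q = Q"
    using P Q mult_carrier_mat[of P m m Q m] by (auto simp: is_projection_def M_def)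
  have [simp]: "P * Q = M" "Q * P = M"
    unfolding M_def by (rule refl, rule comm[symmetric])
  have [simp]: "P * M = M" "M * Q = M"
    using assoc_mult_mat[OF PQ(1) PQ(1,2)] assoc_mult_mat[OF PQ(1,2) PQ(2)] by simp_all
  have [simp]: "Q * M = M" "M * P = M"
    using assoc_mult_mat[OF PQ(2) PQ(2,1)] assoc_mult_mat[OF PQ(2,1) PQ(1)] by simp_all
  note distrib = mult_add_distrib_mat[of _ m m _ m]
    minus_mult_distrib_mat[of _ m m _ _ m] add_mult_distrib_mat[of _ m m _ _ m]
    mult_smult_distrib[of _ m m _ m] mult_smult_assoc_mat[of _ m m _ m]
    add_smult_distrib_left_mat[of _ m m]
  have half: "3 / 2 * x + 3 / 2 * x = x + x + x" for x :: 'a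
  proof -
    have "3 / 2 * x + 3 / 2 * x = 2 * (3 / 2) * x"
      by (simp only: mult_2 distrib_right)
    also have "2 * (3 / 2) = (1 + 1 + 1 :: 'a)"
      by (simp add: conjugatable_two_neq_zero)
    finally show ?thesis
      by (simp only: distrib_right mult_1_left)
  qed
  have smult: "(3 / 2) \<cdot>\<^sub>m M + (3 / 2) \<cdot>\<^sub>m M = M + M + M"
  proof (rule eq_matI)
    fix i j
    assume "i < dim_row (M + M + M)" "j < dim_col (M + M + M)"
    then show "((3 / 2) \<cdot>\<^sub>m M + (3 / 2) \<cdot>\<^sub>m M) $$ (i, j) = (M + M + M) $$ (i, j)"
      using half[of "M $$ (i, j)"] by (simp del: times_divide_eq_left)
  qed auto
  have cancel: "P + M + (M + Q) - (M + M + M) = P + Q - M"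
    by (rule eq_matI) (auto simp: PQ[THEN carrier_matD(1)] PQ[THEN carrier_matD(2)])
  have AB: "(P + Q) * (P + Q - (3 / 2) \<cdot>\<^sub>m M) = P + Q - M"
  proof -
    have "(P + Q) * (P + Q - (3 / 2) \<cdot>\<^sub>m M) = (P + Q) * (P + Q) - (P + Q) * ((3 / 2) \<cdot>\<^sub>m M)"
      by (rule mult_minus_distrib_mat[of _ m m _ m]) simp_all
    also have "(P + Q) * (P + Q) = P + M + (M + Q)"
      by (simp add: distrib)
    also have "(P + Q) * ((3 / 2) \<cdot>\<^sub>m M) = (3 / 2) \<cdot>\<^sub>m M + (3 / 2) \<cdot>\<^sub>m M"
      by (simp add: distrib)
    finally show ?thesis
      by (simp only: smult cancel)
  qed
  have BA: "(P + Q - (3 / 2) \<cdot>\<^sub>m M) * (P + Q) = P + Q - M"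
  proof -
    have "(P + Q - (3 / 2) \<cdot>\<^sub>m M) * (P + Q) = (P + Q) * (P + Q) - (3 / 2) \<cdot>\<^sub>m M * (P + Q)"
      by (rule minus_mult_distrib_mat[of _ m m _ _ m]) simp_all
    also have "(P + Q) * (P + Q) = P + M + (M + Q)"
      by (simp add: distrib)
    also have "(3 / 2) \<cdot>\<^sub>m M * (P + Q) = (3 / 2) \<cdot>\<^sub>m M + (3 / 2) \<cdot>\<^sub>m M"
      by (simp add: distrib)
    finally show ?thesis
      by (simp only: smult cancel)
  qed
  have "(P + Q - M) * (P + Q) = P + M + (M + Q) - (M + M)"
    by (simp add: distrib)
  also have "\<dots> = P + Q"
    by (rule eq_matI) (auto simp: PQ[THEN carrier_matD(1)] PQ[THEN carrier_matD(2)])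
  finally have "(P + Q - M) * (P + Q) = P + Q" .
  moreover have "P + Q - (3 / 2) \<cdot>\<^sub>m M \<in> carrier_mat m m"
    by (intro minus_carrier_mat) simp
  ultimately show ?thesis
    using AB BA unfolding M_def[symmetric]
    by unfold_locales simp_all
qed

end

lemma proj_join_meet_pinv:
  fixes P Q :: "'a :: conjugatable_ordered_field mat"
  assumes P: "is_projection m P" and Q: "is_projection m Q" and comm: "P * Q = Q * P"
  shows
    "(let S = (P + Q) * pinv (P + Q); T = pinv (P + Q) * (P + Q) in
           proj_join P Q = P + Q - P * Q \<and>
           P + Q - P * Q = S * pinv (T * S) * T \<and>
           (is_orthogonal_projection m P \<and> is_orthogonal_projection m Q \<longrightarrow>
              S = T \<and> proj_join P Q = (P + Q) * pinv (P + Q)))" (is ?join)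
    "(let S = (P * Q) * pinv (P * Q); T = pinv (P * Q) * (P * Q) in
           proj_meet P Q = P * Q \<and>
           P * Q = S * pinv (T * S) * T \<and>
           (is_orthogonal_projection m P \<and> is_orthogonal_projection m Q \<longrightarrow>
              S = T \<and> proj_meet P Q = P * Q \<and> P * Q = (P * Q) * pinv (P * Q)))" (is ?meet)
proof -
  have PQ: "P \<in> carrier_mat m m" "Q \<in> carrier_mat m m"
    using P Q by (auto simp: is_projection_def)
  interpret join: group_invertible m "P + Q" "P + Q - (3 / 2) \<cdot>\<^sub>m (P * Q)" "P + Q - P * Q"
    using P Q comm by (rule group_invertible_join)
  interpret meet: group_invertible m "P * Q" "P * Q" "P * Q"
    using P Q comm by (rule group_invertible_meet)
  have adj: "mat_adjoint (P * Q) = P * Q" "mat_adjoint (P + Q - P * Q) = P + Q - P * Q"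
    if "is_orthogonal_projection m P \<and> is_orthogonal_projection m Q"
  proof -
    have "mat_adjoint P = P" "mat_adjoint Q = Q"
      using that by (auto simp: is_orthogonal_projection_def)
    then show *: "mat_adjoint (P * Q) = P * Q"
      using mat_adjoint_mult[OF PQ] comm by simp
    show "mat_adjoint (P + Q - P * Q) = P + Q - P * Q"
      using PQ * \<open>mat_adjoint P = P\<close> \<open>mat_adjoint Q = Q\<close>
      by (simp add: mat_adjoint_minus[of _ m m] mat_adjoint_add[of _ m m])
  qed
  show ?join
    unfolding Let_def proj_join_def
    by (intro conjI impI)
      (simp_all only: join.S_pinv_TS_T join.S_eq_E[OF adj(2)] join.T_eq_E[OF adj(2)] simp_thms)
  show ?meet
    unfolding Let_def proj_meet_def
    by (intro conjI impI)
      (simp_all only: meet.S_pinv_TS_T meet.S_eq_E[OF adj(1)] meet.T_eq_E[OF adj(1)] simp_thms)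
qed

theorem theorem8p5:
  shows
    "(\<forall>(m :: nat) (P :: real mat) (Q :: real mat).
        is_projection m P \<longrightarrow> is_projection m Q \<longrightarrow> P * Q = Q * P \<longrightarrow>
        (let S = (P + Q) * pinv (P + Q); T = pinv (P + Q) * (P + Q) in
           proj_join P Q = P + Q - P * Q \<and>
           P + Q - P * Q = S * pinv (T * S) * T \<and>
           (is_orthogonal_projection m P \<and> is_orthogonal_projection m Q \<longrightarrow>
              S = T \<and> proj_join P Q = (P + Q) * pinv (P + Q))) \<and>
        (let S = (P * Q) * pinv (P * Q); T = pinv (P * Q) * (P * Q) in
           proj_meet P Q = P * Q \<and>
           P * Q = S * pinv (T * S) * T \<and>
           (is_orthogonal_projection m P \<and> is_orthogonal_projection m Q \<longrightarrow>
              S = T \<and> proj_meet P Q = P * Q \<and> P * Q = (P * Q) * pinv (P * Q)))) \<and>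
     (\<forall>(m :: nat) (P :: complex mat) (Q :: complex mat).
        is_projection m P \<longrightarrow> is_projection m Q \<longrightarrow> P * Q = Q * P \<longrightarrow>
        (let S = (P + Q) * pinv (P + Q); T = pinv (P + Q) * (P + Q) in
           proj_join P Q = P + Q - P * Q \<and>
           P + Q - P * Q = S * pinv (T * S) * T \<and>
           (is_orthogonal_projection m P \<and> is_orthogonal_projection m Q \<longrightarrow>
              S = T \<and> proj_join P Q = (P + Q) * pinv (P + Q))) \<and>
        (let S = (P * Q) * pinv (P * Q); T = pinv (P * Q) * (P * Q) in
           proj_meet P Q = P * Q \<and>
           P * Q = S * pinv (T * S) * T \<and>
           (is_orthogonal_projection m P \<and> is_orthogonal_projection m Q \<longrightarrow>
              S = T \<and> proj_meet P Q = P * Q \<and> P * Q = (P * Q) * pinv (P * Q))))"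
  by (rule conjI; (rule allI)+; (rule impI)+;
      rule conjI[OF proj_join_meet_pinv(1) proj_join_meet_pinv(2)]; assumption)

end
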